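(* Let $\lambda,\mu$ be two (nonempty) integer partitions such that $\lambda\succeq_{*}\mu$, and let $c>0$. If $|\lambda|>|\mu|$, let $$\delta=-c\left(\frac{|\lambda|-|\mu|}{|\lambda|}\right)\left(c\,\frac{|\mu|}{|\lambda|}\right)^{\frac{|\mu|}{|\lambda|-|\mu|}},$$ and if $|\lambda|=|\mu|$, let $\delta=0$. Then for any $n\ge|\lambda|$, the inequality $$m_\lambda^{(n)}(x)-c\,m_\mu^{(n)}(x)\ \ge\ \delta\quad\text{on }\mathbb{R}_{>0}^n$$ is valid for: (1) any $c>0$ if $|\lambda|>|\mu|$. In this case, the inequality is an equality if and only if $$x_1=\cdots=x_n=\left(c\,\frac{|\mu|}{|\lambda|}\right)^{\frac{1}{|\lambda|-|\mu|}}.$$ (2) any $0<c\le 1$ if $|\lambda|=|\mu|$. The inequality is then always strict except if $c=1$. In the case $c=1$, equality occurs on all of $\mathbb{R}_{>0}^n$ if $\lambda=\mu$, and (exactly) on the diagonal $\{x\in\mathbb{R}_{>0}^n: x_1=\cdots=x_n\}$ otherwise.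
   Context: For an integer partition $\lambda$, $|\lambda|=\sum_i\lambda_i$. Partitions are regarded as vectors in $\mathbb{R}^N$ by appending zeros, for $N$ at least the number of parts. For $\lambda,\mu\in\mathbb{R}^N$, $\lambda\succeq_{*}\mu$ means that $\mu$ lies in the convex hull of $\{0\}\cup\mathcal{S}_N\cdot\lambda$, where $\mathcal{S}_N\cdot\lambda$ is the orbit of $\lambda$ under permutation of coordinates (for partitions this condition does not depend on the choice of $N$). For $\alpha\in\mathbb{N}^n$, the monomial mean is $m_\alpha^{(n)}(x)=\frac{1}{n!}\sum_{\sigma\in\mathcal{S}_n}x_{\sigma(1)}^{\alpha_1}\cdots x_{\sigma(n)}^{\alpha_n}$, i.e. the average of the monomials $x^\beta$ over all $\beta$ in the $\mathcal{S}_n$-orbit of $\alpha$. *)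

theory Defs
  imports "HOL-Analysis.Analysis" "HOL-Analysis.Finite_Function_Topology"
    "HOL-Combinatorics.Permutations"
begin

text \<open>
  An integer partition is the weakly decreasing list of its (positive) parts; its size is
  \<^const>\<open>sum_list\<close>, and \<^term>\<open>nth_default 0 lam i\<close> is the \<open>i\<close>-th entry (indices start at 0)
  of the vector obtained from it by appending zeros.
\<close>

definition is_partition :: "nat list \<Rightarrow> bool" where
  "is_partition lam \<longleftrightarrow> sorted_wrt (\<ge>) lam \<and> (\<forall>k\<in>set lam. 0 < k)"

text \<open>
  \<open>\<real>\<^sup>N\<close> is the subspace of the real vector space of finitely supported real sequences whose
  members are supported on \<open>{..<N}\<close>. In this way \<open>N\<close> can be a natural number instead of a type.
\<close>

definition partition_vec :: "nat list \<Rightarrow> nat \<Rightarrow>\<^sub>0 real" where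
  "partition_vec lam = Poly_Mapping.nth (map real lam)"

definition perm_orbit :: "nat \<Rightarrow> (nat \<Rightarrow>\<^sub>0 real) \<Rightarrow> (nat \<Rightarrow>\<^sub>0 real) set" where
  "perm_orbit N v = {w. \<exists>\<sigma>. \<sigma> permutes {..<N} \<and> (\<forall>i. Poly_Mapping.lookup w i = Poly_Mapping.lookup v (\<sigma> i))}"

text \<open>The relation \<open>v \<succeq>\<^sub>* w\<close>, for \<open>v\<close> and \<open>w\<close> supported on \<open>{..<N}\<close>.\<close>

definition star_dominates :: "nat \<Rightarrow> (nat \<Rightarrow>\<^sub>0 real) \<Rightarrow> (nat \<Rightarrow>\<^sub>0 real) \<Rightarrow> bool" where
  "star_dominates N v w \<longleftrightarrow> w \<in> convex hull ({0} \<union> perm_orbit N v)"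

text \<open>Only the entries of \<open>\<alpha>\<close> and \<open>x\<close> with index below \<open>n\<close> matter.\<close>

definition monomial_mean :: "nat \<Rightarrow> (nat \<Rightarrow> nat) \<Rightarrow> (nat \<Rightarrow> real) \<Rightarrow> real" where
  "monomial_mean n \<alpha> x = (1 / fact n) * (\<Sum>\<sigma> | \<sigma> permutes {..<n}. \<Prod>i<n. x (\<sigma> i) ^ \<alpha> i)"

definition partition_mean :: "nat \<Rightarrow> nat list \<Rightarrow> (nat \<Rightarrow> real) \<Rightarrow> real" where
  "partition_mean n lam x = monomial_mean n (nth_default 0 lam) x"

end

theory Submission
  imports Defs
begin

text \<open>
  Put \<open>y = ln x\<close>, and for a real exponent vector \<open>w\<close> let \<open>E(w)\<close> be the average of
  \<open>exp (\<Sum>i<n. w\<^sub>i y\<^bsub>\<sigma>(i)\<^esub>)\<close> over all permutations \<open>\<sigma>\<close>; this extends the monomial mean to real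
  exponents, and the whole theorem follows from the strict convexity of \<open>exp\<close>, applied to single
  summands.

  By the hypothesis \<open>\<mu> = \<theta> \<nu>\<close> with \<open>\<nu>\<close> in the convex hull of the orbit of \<open>\<lambda>\<close>. Comparing sums
  of entries gives \<open>\<theta> = M / L\<close>. Since \<open>E\<close> is convex and takes the value \<open>E(\<lambda>)\<close> on the whole
  orbit, \<open>E(\<nu>) \<le> E(\<lambda>)\<close>. For non-constant \<open>x\<close> this is strict unless \<open>\<nu>\<close> is itself in the orbit
  (\<open>exp_mean_less_on_hull\<close>), because an exponent vector whose pairing with \<open>y\<close> does not depend on
  \<open>\<sigma>\<close> must be constant (\<open>pairing_distinguishes\<close>). For \<open>L = M\<close> we have \<open>\<nu> = \<mu>\<close>, and two partitions
  that are rearrangements of each other are equal, which settles this case.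

  For \<open>L > M\<close> we have \<open>\<theta> < 1\<close>. With \<open>b = ln (c \<theta>) / (1 - \<theta>)\<close>, convexity of \<open>exp\<close> between \<open>z\<close> and
  \<open>b\<close> reads \<open>c exp (\<theta> z) \<le> exp z + c (1 - \<theta>) exp (\<theta> b)\<close>, with equality only for \<open>z = b\<close>
  (\<open>scaled_exp_bound\<close>), and the last summand is exactly \<open>-\<delta>\<close>. Averaging over all pairings \<open>z\<close> of
  \<open>\<nu>\<close> with \<open>y\<close> yields \<open>c E(\<mu>) \<le> E(\<nu>) - \<delta> \<le> E(\<lambda>) - \<delta>\<close>. Equality forces all these pairings to equal
  \<open>b\<close>. As \<open>n \<ge> L > M\<close>, the partition \<open>\<mu>\<close> has fewer than \<open>n\<close> parts, so \<open>\<nu>\<close> is not constant;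
  hence \<open>y\<close> is constant, and its value is \<open>b / L\<close>.
\<close>

section \<open>Strict convexity of the exponential function\<close>

lemma exp_strict_convex:
  fixes a b t :: real
  assumes "0 < t" "t < 1" "a \<noteq> b"
  shows "exp (t * a + (1 - t) * b) < t * exp a + (1 - t) * exp b"
proof -
  define m where "m = t * a + (1 - t) * b"
  have ma: "a - m = (1 - t) * (a - b)" and mb: "b - m = - t * (a - b)"
    by (simp_all add: m_def algebra_simps)
  have ne: "a - m \<noteq> 0" "b - m \<noteq> 0"
    unfolding ma mb using assms by auto
  \<comment> \<open>The tangent at \<open>m\<close> lies strictly below the graph away from \<open>m\<close>; the convex combination of its
    values at \<open>a\<close> and \<open>b\<close> is its value at \<open>m\<close>, namely \<open>exp m\<close>.\<close>
  have tangent: "exp m * (1 + (x - m)) < exp x" if "x - m \<noteq> 0" for x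
  proof -
    have "1 + (x - m) \<noteq> exp (x - m)"
    proof
      assume "1 + (x - m) = exp (x - m)"
      then have "exp (x - m) = 1" by (intro ln_eq_minus_one) auto
      then show False using that by simp
    qed
    then have "1 + (x - m) < exp (x - m)"
      using exp_ge_add_one_self[of "x - m"] by linarith
    then have "exp m * (1 + (x - m)) < exp m * exp (x - m)" by simp
    then show ?thesis by (simp flip: exp_add)
  qed
  have "exp m = t * (exp m * (1 + (a - m))) + (1 - t) * (exp m * (1 + (b - m)))"
    unfolding ma mb by (simp add: algebra_simps)
  also have "\<dots> < t * exp a + (1 - t) * exp b"
    using tangent[OF ne(1)] tangent[OF ne(2)] assms by (intro add_strict_mono mult_strict_left_mono) auto
  finally show ?thesis by (simp add: m_def)
qed

lemma exp_convex:
  fixes a b t :: real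
  assumes "0 < t" "t < 1"
  shows "exp (t * a + (1 - t) * b) \<le> t * exp a + (1 - t) * exp b"
  using exp_strict_convex[OF assms, of a b] by (cases "a = b") (auto simp: algebra_simps)

text \<open>
  Convexity of \<open>exp\<close> in the form in which \<open>c\<close> multiplies only the term with the smaller exponent.
  The point \<open>b\<close> is where \<open>exp z - c * exp (\<theta> * z)\<close> is minimal.
\<close>

lemma scaled_exp_bound:
  fixes c \<theta> b z :: real
  assumes c: "c > 0" and \<theta>: "0 < \<theta>" "\<theta> < 1" and b: "b = ln (c * \<theta>) / (1 - \<theta>)"
  shows "c * exp (\<theta> * z) \<le> exp z + c * (1 - \<theta>) * exp (\<theta> * b)"
    and "c * exp (\<theta> * z) = exp z + c * (1 - \<theta>) * exp (\<theta> * b) \<longleftrightarrow> z = b"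
proof -
  \<comment> \<open>Multiplying the convexity inequality by \<open>g\<close> turns its left-hand side into \<open>c * exp (\<theta> * z)\<close>;
    \<open>b\<close> is the value for which the coefficient \<open>g * \<theta>\<close> of \<open>exp z\<close> becomes 1.\<close>
  define g where "g = c * exp (- (1 - \<theta>) * b)"
  have "(1 - \<theta>) * b = ln (c * \<theta>)" using \<theta> b by simp
  then have "exp (- (1 - \<theta>) * b) = 1 / (c * \<theta>)"
    using c \<theta> by (simp only: mult_minus_left exp_minus) (simp add: field_simps)
  then have g1: "g * \<theta> = 1" using c \<theta> by (simp add: g_def field_simps)
  have g2: "g * exp b = c * exp (\<theta> * b)"
    by (simp add: g_def mult.assoc flip: exp_add) (simp add: algebra_simps)
  have lhs: "g * exp (\<theta> * w + (1 - \<theta>) * b) = c * exp (\<theta> * w)" for w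
  proof -
    have "exp (- (1 - \<theta>) * b) * exp (\<theta> * w + (1 - \<theta>) * b) = exp (\<theta> * w)"
      unfolding exp_add[symmetric] by (simp add: algebra_simps)
    then show ?thesis by (simp only: g_def mult.assoc)
  qed
  have rhs: "g * (\<theta> * exp w + (1 - \<theta>) * exp b) = exp w + c * (1 - \<theta>) * exp (\<theta> * b)" for w
  proof -
    have "g * (\<theta> * exp w + (1 - \<theta>) * exp b) = (g * \<theta>) * exp w + (1 - \<theta>) * (g * exp b)"
      by (simp add: algebra_simps)
    then show ?thesis by (simp add: g1 g2)
  qed
  have gpos: "g > 0" using c by (simp add: g_def)
  have less: "c * exp (\<theta> * z) < exp z + c * (1 - \<theta>) * exp (\<theta> * b)" if "z \<noteq> b"
    unfolding lhs[of z, symmetric] rhs[of z, symmetric]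
    by (intro mult_strict_left_mono exp_strict_convex \<theta> that gpos)
  have eq: "c * exp (\<theta> * b) = exp b + c * (1 - \<theta>) * exp (\<theta> * b)"
    unfolding lhs[of b, symmetric] rhs[of b, symmetric] by (simp add: algebra_simps)
  show "c * exp (\<theta> * z) \<le> exp z + c * (1 - \<theta>) * exp (\<theta> * b)"
    using less eq by (cases "z = b") auto
  show "c * exp (\<theta> * z) = exp z + c * (1 - \<theta>) * exp (\<theta> * b) \<longleftrightarrow> z = b"
    using less eq by (cases "z = b") auto
qed

section \<open>Averages over permutations\<close>

definition perm_avg :: "nat \<Rightarrow> ((nat \<Rightarrow> nat) \<Rightarrow> real) \<Rightarrow> real" where
  "perm_avg n F = (1 / fact n) * (\<Sum>\<sigma> | \<sigma> permutes {..<n}. F \<sigma>)"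

lemma perm_avg_add: "perm_avg n (\<lambda>\<sigma>. F \<sigma> + G \<sigma>) = perm_avg n F + perm_avg n G"
  by (simp add: perm_avg_def sum.distrib distrib_left add_divide_distrib)

lemma perm_avg_cmult: "perm_avg n (\<lambda>\<sigma>. a * F \<sigma>) = a * perm_avg n F"
  by (simp add: perm_avg_def sum_distrib_left sum_divide_distrib)

lemma perm_avg_cong:
  "(\<And>\<sigma>. \<sigma> permutes {..<n} \<Longrightarrow> F \<sigma> = G \<sigma>) \<Longrightarrow> perm_avg n F = perm_avg n G"
  by (simp add: perm_avg_def)

lemma perm_avg_const: "perm_avg n (\<lambda>\<sigma>. a) = a"
  by (simp add: perm_avg_def card_permutations)

lemma perm_avg_mono:
  "(\<And>\<sigma>. \<sigma> permutes {..<n} \<Longrightarrow> F \<sigma> \<le> G \<sigma>) \<Longrightarrow> perm_avg n F \<le> perm_avg n G"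
  by (auto simp: perm_avg_def intro!: divide_right_mono sum_mono)

lemma perm_avg_strict_mono:
  assumes "\<And>\<sigma>. \<sigma> permutes {..<n} \<Longrightarrow> F \<sigma> \<le> G \<sigma>"
    and "\<tau> permutes {..<n}" "F \<tau> < G \<tau>"
  shows "perm_avg n F < perm_avg n G"
proof -
  have "(\<Sum>\<sigma> | \<sigma> permutes {..<n}. F \<sigma>) < (\<Sum>\<sigma> | \<sigma> permutes {..<n}. G \<sigma>)"
    using assms by (intro sum_strict_mono_ex1) (auto simp: finite_permutations)
  then show ?thesis by (simp add: perm_avg_def divide_strict_right_mono)
qed

lemma permutes_lessThan_less: "\<sigma> permutes {..<n} \<Longrightarrow> \<sigma> i < n \<longleftrightarrow> i < n"
  using permutes_in_image[of \<sigma> "{..<n}" i] by simp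

section \<open>Monomial means with real exponents\<close>

definition pairing :: "nat \<Rightarrow> (nat \<Rightarrow> real) \<Rightarrow> (nat \<Rightarrow> real) \<Rightarrow> (nat \<Rightarrow> nat) \<Rightarrow> real" where
  "pairing n w y \<sigma> = (\<Sum>i<n. w i * y (\<sigma> i))"

text \<open>
  For \<open>y = ln x\<close> this is the monomial mean of \<open>x\<close> with exponent vector \<open>w\<close>, now for real exponents.
\<close>

definition exp_mean :: "nat \<Rightarrow> (nat \<Rightarrow> real) \<Rightarrow> (nat \<Rightarrow> real) \<Rightarrow> real" where
  "exp_mean n w y = perm_avg n (\<lambda>\<sigma>. exp (pairing n w y \<sigma>))"

lemma partition_mean_eq_exp_mean:
  assumes "\<forall>i<n. x i > 0"
  shows "partition_mean n lam x = exp_mean n (\<lambda>i. real (nth_default 0 lam i)) (\<lambda>i. ln (x i))"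
  unfolding partition_mean_def monomial_mean_def exp_mean_def perm_avg_def[symmetric] pairing_def
proof (rule perm_avg_cong)
  fix \<sigma> assume \<sigma>: "\<sigma> permutes {..<n}"
  show "(\<Prod>i<n. x (\<sigma> i) ^ nth_default 0 lam i)
      = exp (\<Sum>i<n. real (nth_default 0 lam i) * ln (x (\<sigma> i)))"
    using assms by (auto simp: exp_sum exp_of_nat_mult permutes_lessThan_less[OF \<sigma>] intro!: prod.cong)
qed

lemma exp_mean_const:
  assumes "\<forall>i<n. y i = a"
  shows "exp_mean n w y = exp (a * (\<Sum>i<n. w i))"
proof -
  have "exp_mean n w y = perm_avg n (\<lambda>\<sigma>. exp (a * (\<Sum>i<n. w i)))"
    unfolding exp_mean_def pairing_def
    by (rule perm_avg_cong) (use assms in \<open>auto simp: sum_distrib_left permutes_lessThan_less mult.commute intro!: sum.cong\<close>)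
  then show ?thesis by (simp add: perm_avg_const)
qed

lemma exp_mean_perm:
  assumes \<rho>: "\<rho> permutes {..<n}"
  shows "exp_mean n (\<lambda>i. w (\<rho> i)) y = exp_mean n w y"
proof -
  have "pairing n (\<lambda>i. w (\<rho> i)) y (\<sigma> \<circ> \<rho>) = pairing n w y \<sigma>" for \<sigma>
    unfolding pairing_def o_def
    using sum.permute[OF \<rho>, of "\<lambda>i. w i * y (\<sigma> i)"] by (simp add: o_def)
  then show ?thesis
    unfolding exp_mean_def perm_avg_def
    by (subst sum_permutations_compose_right[OF \<rho>]) simp
qed

lemma pairing_lincomb:
  "pairing n (\<lambda>i. s * u i + t * w i) y \<sigma> = s * pairing n u y \<sigma> + t * pairing n w y \<sigma>"
  by (simp add: pairing_def sum.distrib sum_distrib_left algebra_simps)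

text \<open>
  The source of all equality statements. If \<open>\<sigma>\<close> sends \<open>p\<close> to \<open>i\<close> and \<open>q\<close> to \<open>j\<close>, then exchanging the
  images of \<open>p\<close> and \<open>q\<close> changes the pairing by \<open>(d p - d q) * (y i - y j)\<close>.
\<close>

lemma pairing_distinguishes:
  assumes pq: "p < n" "q < n" "d p \<noteq> d q"
    and eq: "\<And>\<sigma> \<tau>. \<sigma> permutes {..<n} \<Longrightarrow> \<tau> permutes {..<n} \<Longrightarrow> pairing n d y \<sigma> = pairing n d y \<tau>"
  shows "\<forall>i<n. \<forall>j<n. y i = y j"
proof (intro allI impI)
  fix i j assume ij: "i < n" "j < n"
  show "y i = y j"
  proof (cases "i = j")
    case False
    \<comment> \<open>A permutation that sends \<open>p\<close> to \<open>i\<close> and \<open>q\<close> to \<open>j\<close>: first move \<open>p\<close> to \<open>i\<close>, then correct the image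
      of \<open>q\<close>, which leaves \<open>i\<close> alone because \<open>i\<close> is neither \<open>\<tau>0 q\<close> nor \<open>j\<close>.\<close>
    define \<tau>0 where "\<tau>0 = Transposition.transpose p i"
    have \<tau>0: "\<tau>0 permutes {..<n}" "\<tau>0 p = i"
      using pq ij by (auto simp: \<tau>0_def intro: permutes_swap_id)
    define \<sigma> where "\<sigma> = Transposition.transpose (\<tau>0 q) j \<circ> \<tau>0"
    have "\<tau>0 q < n" "\<tau>0 q \<noteq> i"
      using pq \<tau>0 permutes_inj[OF \<tau>0(1)] by (auto simp: permutes_lessThan_less dest: injD)
    then have \<sigma>: "\<sigma> permutes {..<n}" "\<sigma> p = i" "\<sigma> q = j"
      using \<tau>0 ij False by (auto simp: \<sigma>_def Transposition.transpose_def intro!: permutes_compose permutes_swap_id)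
    have pqn: "p \<noteq> q" using pq by auto
    have tr: "Transposition.transpose p q permutes {..<n}"
      using pq by (auto intro: permutes_swap_id)
    have "pairing n d y \<sigma> = pairing n d y (\<sigma> \<circ> Transposition.transpose p q)"
      by (intro eq \<sigma> permutes_compose tr)
    then have "0 = (\<Sum>k<n. d k * (y (\<sigma> k) - y (\<sigma> (Transposition.transpose p q k))))"
      by (simp add: pairing_def right_diff_distrib sum_subtractf)
    also have "\<dots> = (\<Sum>k\<in>{p, q}. d k * (y (\<sigma> k) - y (\<sigma> (Transposition.transpose p q k))))"
      using pq by (intro sum.mono_neutral_right) (auto simp: Transposition.transpose_def)
    also have "\<dots> = (d p - d q) * (y i - y j)"
      using \<sigma> pqn by (simp add: algebra_simps)
    finally show ?thesis using pq by simp
  qed auto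
qed

lemma exp_mean_convex:
  assumes "0 < t" "t < 1"
  shows "exp_mean n (\<lambda>i. t * u i + (1 - t) * w i) y \<le> t * exp_mean n u y + (1 - t) * exp_mean n w y"
  unfolding exp_mean_def pairing_lincomb perm_avg_cmult[symmetric] perm_avg_add[symmetric]
  by (intro perm_avg_mono exp_convex assms)

text \<open>
  Equality would make the pairing with \<open>u - w\<close> vanish for every permutation, which
  \<open>pairing_distinguishes\<close> excludes.
\<close>

lemma exp_mean_strict_convex:
  assumes t: "0 < t" "t < 1"
    and y: "\<not> (\<forall>i<n. \<forall>j<n. y i = y j)"
    and pq: "p < n" "q < n" "u p - w p \<noteq> u q - w q"
  shows "exp_mean n (\<lambda>i. t * u i + (1 - t) * w i) y < t * exp_mean n u y + (1 - t) * exp_mean n w y"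
proof -
  have "\<exists>\<tau>. \<tau> permutes {..<n} \<and> pairing n u y \<tau> \<noteq> pairing n w y \<tau>"
  proof (rule ccontr)
    assume "\<not> ?thesis"
    moreover have "pairing n (\<lambda>i. u i - w i) y \<sigma> = pairing n u y \<sigma> - pairing n w y \<sigma>" for \<sigma>
      by (simp add: pairing_def sum_subtractf algebra_simps)
    ultimately have "\<forall>i<n. \<forall>j<n. y i = y j"
      using pq by (intro pairing_distinguishes[of p n q "\<lambda>i. u i - w i"]) auto
    then show False using y by blast
  qed
  then obtain \<tau> where "\<tau> permutes {..<n}" "pairing n u y \<tau> \<noteq> pairing n w y \<tau>" by blast
  then show ?thesis
    unfolding exp_mean_def pairing_lincomb perm_avg_cmult[symmetric] perm_avg_add[symmetric]
    using t by (intro perm_avg_strict_mono[of n _ _ \<tau>] exp_convex exp_strict_convex)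
qed

text \<open>
  Equality between a mean and its scaled version would require every pairing to be at the single
  point \<open>b\<close> where \<open>scaled_exp_bound\<close> is sharp, which is impossible for non-constant \<open>w\<close> and \<open>y\<close>.
\<close>

lemma exp_mean_scaled_bound:
  fixes c \<theta> b :: real
  assumes c: "c > 0" and \<theta>: "0 < \<theta>" "\<theta> < 1" and b: "b = ln (c * \<theta>) / (1 - \<theta>)"
    and pq: "p < n" "q < n" "w p \<noteq> w q"
    and y: "\<not> (\<forall>i<n. \<forall>j<n. y i = y j)"
  shows "c * exp_mean n (\<lambda>i. \<theta> * w i) y < exp_mean n w y + c * (1 - \<theta>) * exp (\<theta> * b)"
proof -
  have "\<exists>\<tau>. \<tau> permutes {..<n} \<and> pairing n w y \<tau> \<noteq> b"
    using pairing_distinguishes[of p n q w y] pq y by metis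
  then obtain \<tau> where \<tau>: "\<tau> permutes {..<n}" "pairing n w y \<tau> \<noteq> b" by blast
  have scale: "pairing n (\<lambda>i. \<theta> * w i) y \<sigma> = \<theta> * pairing n w y \<sigma>" for \<sigma>
    by (simp add: pairing_def sum_distrib_left algebra_simps)
  have bound: "c * exp (\<theta> * z) \<le> exp z + c * (1 - \<theta>) * exp (\<theta> * b)"
    and strict: "z \<noteq> b \<Longrightarrow> c * exp (\<theta> * z) < exp z + c * (1 - \<theta>) * exp (\<theta> * b)" for z
    using scaled_exp_bound[OF c \<theta> b, of z] by auto
  have "c * exp_mean n (\<lambda>i. \<theta> * w i) y = perm_avg n (\<lambda>\<sigma>. c * exp (\<theta> * pairing n w y \<sigma>))"
    by (simp add: exp_mean_def scale perm_avg_cmult)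
  also have "\<dots> < perm_avg n (\<lambda>\<sigma>. exp (pairing n w y \<sigma>) + c * (1 - \<theta>) * exp (\<theta> * b))"
    using bound strict[OF \<tau>(2)] by (intro perm_avg_strict_mono[of n _ _ \<tau>] \<tau>(1))
  also have "\<dots> = exp_mean n w y + c * (1 - \<theta>) * exp (\<theta> * b)"
    by (simp add: exp_mean_def perm_avg_add perm_avg_const)
  finally show ?thesis .
qed

section \<open>Permutation orbits and their convex hulls\<close>

lemma lookup_scaleR: "Poly_Mapping.lookup (r *\<^sub>R w) i = r * Poly_Mapping.lookup w i"
  by (simp add: scaleR_poly_mapping_def)

text \<open>
  The dimension \<open>N\<close> in which the convex hull is formed is unrelated to the number \<open>n\<close> of variables.
  Both vectors vanish from \<open>n\<close> on, so cancelling the surplus zeros shows that their first \<open>n\<close>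
  entries form the same multiset.
\<close>

lemma perm_orbit_restrict:
  assumes w: "w \<in> perm_orbit N v"
    and v0: "\<And>i. i \<ge> n \<Longrightarrow> Poly_Mapping.lookup v i = 0"
    and w0: "\<And>i. i \<ge> n \<Longrightarrow> Poly_Mapping.lookup w i = 0"
  shows "w \<in> perm_orbit n v"
proof -
  let ?v = "Poly_Mapping.lookup v" and ?w = "Poly_Mapping.lookup w"
  \<comment> \<open>\<open>N\<close> may lie on either side of \<open>n\<close>; below \<open>K\<close> both multisets of entries can be compared.\<close>
  define K where "K = max N n"
  obtain \<sigma> where "\<sigma> permutes {..<N}" and ws: "\<And>i. ?w i = ?v (\<sigma> i)"
    using w by (auto simp: perm_orbit_def)
  then have \<sigma>: "\<sigma> permutes {..<K}"
    by (auto simp: K_def intro: permutes_subset)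
  have split: "mset_set {..<K} = mset_set {..<n} + mset_set {n..<K}"
    by (subst mset_set_Union[symmetric]) (auto simp: K_def intro: arg_cong[of _ _ mset_set])
  have "image_mset ?w (mset_set {..<K}) = image_mset ?v (image_mset \<sigma> (mset_set {..<K}))"
    by (simp add: ws multiset.map_comp o_def cong: image_mset_cong)
  also have "\<dots> = image_mset ?v (mset_set {..<K})"
    by (simp add: permutes_image_mset[OF \<sigma>])
  finally have "image_mset ?w (mset_set {..<n}) + image_mset ?w (mset_set {n..<K})
      = image_mset ?v (mset_set {..<n}) + image_mset ?v (mset_set {n..<K})"
    by (simp add: split)
  moreover have "image_mset ?w (mset_set {n..<K}) = image_mset ?v (mset_set {n..<K})"
    by (intro image_mset_cong) (auto simp: v0 w0)
  ultimately have "image_mset ?w (mset_set {..<n}) = image_mset ?v (mset_set {..<n})"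
    by simp
  then obtain \<rho> where \<rho>: "\<rho> permutes {..<n}" "\<forall>i\<in>{..<n}. ?w i = ?v (\<rho> i)"
    using image_mset_eq_implies_permutes[of "{..<n}" ?w ?v] by blast
  have "?w i = ?v (\<rho> i)" for i
    using \<rho> v0[of i] w0[of i] permutes_not_in[OF \<rho>(1), of i] by (cases "i < n") auto
  then show ?thesis
    using \<rho>(1) by (auto simp: perm_orbit_def)
qed

lemma perm_orbit_sum:
  assumes "w \<in> perm_orbit n v"
  shows "(\<Sum>i<n. Poly_Mapping.lookup w i) = (\<Sum>i<n. Poly_Mapping.lookup v i)"
proof -
  obtain \<sigma> where "\<sigma> permutes {..<n}" "\<And>i. Poly_Mapping.lookup w i = Poly_Mapping.lookup v (\<sigma> i)"
    using assms by (auto simp: perm_orbit_def)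
  then show ?thesis
    using sum.permute[of \<sigma> "{..<n}" "Poly_Mapping.lookup v"] by (simp add: o_def)
qed

lemma convex_hull_perm_orbit_sum:
  assumes "w \<in> convex hull (perm_orbit n v)"
  shows "(\<Sum>i<n. Poly_Mapping.lookup w i) = (\<Sum>i<n. Poly_Mapping.lookup v i)"
proof -
  let ?S = "{w. (\<Sum>i<n. Poly_Mapping.lookup w i) = (\<Sum>i<n. Poly_Mapping.lookup v i)}"
  have "convex ?S"
  proof (rule convexI)
    fix a b and s t :: real
    assume "a \<in> ?S" "b \<in> ?S" "s + t = 1"
    then show "s *\<^sub>R a + t *\<^sub>R b \<in> ?S"
      by (simp add: lookup_add lookup_scaleR sum.distrib flip: sum_distrib_left distrib_right)
  qed
  then have "convex hull (perm_orbit n v) \<subseteq> ?S"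
    by (intro hull_minimal) (auto simp: perm_orbit_sum)
  then show ?thesis using assms by auto
qed

lemma exp_mean_perm_orbit:
  assumes "w \<in> perm_orbit n v"
  shows "exp_mean n (Poly_Mapping.lookup w) y = exp_mean n (Poly_Mapping.lookup v) y"
proof -
  obtain \<sigma> where "\<sigma> permutes {..<n}" "Poly_Mapping.lookup w = (\<lambda>i. Poly_Mapping.lookup v (\<sigma> i))"
    using assms by (auto simp: perm_orbit_def fun_eq_iff)
  then show ?thesis by (simp add: exp_mean_perm)
qed

text \<open>
  The convex function \<open>exp_mean\<close> is constant on the orbit, hence bounded by that constant on the
  hull; for non-constant \<open>y\<close>, strict convexity shows that the bound is attained only at orbit points. Since \<open>N\<close> may
  exceed \<open>n\<close>, the hull is taken in the larger space and only its members supported below \<open>n\<close> are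
  compared. As \<open>v\<close> is nonnegative, the points of which such a member is a proper convex
  combination are supported there as well.
\<close>

lemma exp_mean_less_on_hull:
  assumes hull: "\<nu> \<in> convex hull (perm_orbit N v)"
    and nonneg: "\<And>i. 0 \<le> Poly_Mapping.lookup v i"
    and v0: "\<And>i. i \<ge> n \<Longrightarrow> Poly_Mapping.lookup v i = 0"
    and \<nu>0: "\<And>i. i \<ge> n \<Longrightarrow> Poly_Mapping.lookup \<nu> i = 0"
    and y: "\<not> (\<forall>i<n. \<forall>j<n. y i = y j)"
  shows "\<nu> \<in> perm_orbit n v \<or>
    exp_mean n (Poly_Mapping.lookup \<nu>) y < exp_mean n (Poly_Mapping.lookup v) y"
proof -
  define E where "E w = exp_mean n (Poly_Mapping.lookup w) y" for w
  \<comment> \<open>The conclusion alone does not cut out a convex set: a combination of vectors with entries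
    beyond \<open>n\<close> of both signs could be supported below \<open>n\<close>. Nonnegativity excludes this cancellation.\<close>
  define S where "S = {w. (\<forall>i. 0 \<le> Poly_Mapping.lookup w i) \<and>
    ((\<forall>i\<ge>n. Poly_Mapping.lookup w i = 0) \<longrightarrow> w \<in> perm_orbit n v \<or> E w < E v)}"
  have "convex S"
  proof (rule convexI)
    fix a b and s t :: real
    assume a: "a \<in> S" and b: "b \<in> S" and st: "0 \<le> s" "0 \<le> t" "s + t = 1"
    show "s *\<^sub>R a + t *\<^sub>R b \<in> S"
    proof (cases "s = 0 \<or> t = 0 \<or> a = b")
      case True
      then have "s *\<^sub>R a + t *\<^sub>R b = a \<or> s *\<^sub>R a + t *\<^sub>R b = b"
        using st by (auto simp flip: scaleR_add_left)
      then show ?thesis using a b by auto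
    next
      case False
      then have s: "0 < s" "s < 1" and t: "t = 1 - s" and "a \<noteq> b"
        using st by auto
      define c where "c = s *\<^sub>R a + t *\<^sub>R b"
      have c: "Poly_Mapping.lookup c = (\<lambda>i. s * Poly_Mapping.lookup a i + (1 - s) * Poly_Mapping.lookup b i)"
        by (simp add: c_def lookup_add lookup_scaleR fun_eq_iff t)
      have pos: "0 \<le> Poly_Mapping.lookup a i" "0 \<le> Poly_Mapping.lookup b i" for i
        using a b by (auto simp: S_def)
      have "E c < E v" if c0: "\<forall>i\<ge>n. Poly_Mapping.lookup c i = 0"
      proof -
        have zero: "Poly_Mapping.lookup a i = 0 \<and> Poly_Mapping.lookup b i = 0" if "i \<ge> n" for i
        proof -
          have "s * Poly_Mapping.lookup a i + (1 - s) * Poly_Mapping.lookup b i = 0"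
            using c0 that by (simp add: c)
          then show ?thesis
            using pos[of i] s by (simp add: add_nonneg_eq_0_iff)
        qed
        have ab: "a \<in> perm_orbit n v \<or> E a < E v" "b \<in> perm_orbit n v \<or> E b < E v"
          using a b zero by (auto simp: S_def)
        have le: "E a \<le> E v" "E b \<le> E v"
          using ab exp_mean_perm_orbit[of _ n v y] by (auto simp: E_def)
        have conv: "E c \<le> s * E a + (1 - s) * E b"
          unfolding E_def c by (rule exp_mean_convex[OF s])
        have Ev: "E v = s * E v + (1 - s) * E v" by (simp add: algebra_simps)
        show ?thesis
        proof (cases "E a < E v \<or> E b < E v")
          case True
          then have "s * E a + (1 - s) * E b < s * E v + (1 - s) * E v"
            using le s by (auto intro: add_less_le_mono add_le_less_mono)
          then show ?thesis using conv Ev by linarith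
        next
          case False
          \<comment> \<open>Two distinct rearrangements of \<open>v\<close> have the same sum, so their difference is not constant
            and strict convexity applies.\<close>
          then have orb: "a \<in> perm_orbit n v" "b \<in> perm_orbit n v" using ab by auto
          obtain p where p: "Poly_Mapping.lookup a p \<noteq> Poly_Mapping.lookup b p"
            using \<open>a \<noteq> b\<close> by (auto simp: poly_mapping_eq_iff fun_eq_iff)
          then have pn: "p < n" using zero[of p] by (cases "p < n") auto
          have "\<exists>q<n. Poly_Mapping.lookup a p - Poly_Mapping.lookup b p
              \<noteq> Poly_Mapping.lookup a q - Poly_Mapping.lookup b q"
          proof (rule ccontr)
            assume "\<not> ?thesis"
            then have "(\<Sum>q<n. Poly_Mapping.lookup a q - Poly_Mapping.lookup b q)
              = (\<Sum>q<n. Poly_Mapping.lookup a p - Poly_Mapping.lookup b p)"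
              by (intro sum.cong) auto
            then have "(\<Sum>q<n. Poly_Mapping.lookup a q - Poly_Mapping.lookup b q)
              = real n * (Poly_Mapping.lookup a p - Poly_Mapping.lookup b p)"
              by simp
            moreover have "(\<Sum>q<n. Poly_Mapping.lookup a q - Poly_Mapping.lookup b q) = 0"
              using perm_orbit_sum[OF orb(1)] perm_orbit_sum[OF orb(2)] by (simp add: sum_subtractf)
            ultimately show False using p pn by simp
          qed
          then obtain q where q: "q < n" "Poly_Mapping.lookup a p - Poly_Mapping.lookup b p
              \<noteq> Poly_Mapping.lookup a q - Poly_Mapping.lookup b q" by blast
          have "E c < s * E a + (1 - s) * E b"
            unfolding E_def c by (rule exp_mean_strict_convex[where u = "Poly_Mapping.lookup a" and w = "Poly_Mapping.lookup b", OF s y pn q])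
          also have "\<dots> \<le> s * E v + (1 - s) * E v"
            using le s by (intro add_mono mult_left_mono) auto
          finally show ?thesis using Ev by linarith
        qed
      qed
      moreover have "\<forall>i. 0 \<le> Poly_Mapping.lookup c i"
        using pos s by (auto simp: c)
      ultimately show ?thesis by (auto simp: S_def c_def)
    qed
  qed
  moreover have "perm_orbit N v \<subseteq> S"
  proof
    fix w assume w: "w \<in> perm_orbit N v"
    then have "\<forall>i. 0 \<le> Poly_Mapping.lookup w i"
      using nonneg by (auto simp: perm_orbit_def)
    then show "w \<in> S"
      using perm_orbit_restrict[OF w v0] by (auto simp: S_def)
  qed
  ultimately have "convex hull (perm_orbit N v) \<subseteq> S"
    by (intro hull_minimal)
  then show ?thesis
    using hull \<nu>0 by (auto simp: S_def E_def)
qed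

text \<open>
  Including the origin in the convex hull only adds vectors shrunk towards it. Pulling out the factor \<open>\<theta>\<close>
  leaves a member of the hull of the orbit alone, where sums of entries are preserved.
\<close>

lemma star_dominates_scaled:
  assumes "star_dominates N v w"
  obtains \<theta> \<nu> where "\<theta> \<ge> 0" "w = \<theta> *\<^sub>R \<nu>" "\<nu> \<in> convex hull (perm_orbit N v)"
proof -
  have "v \<in> perm_orbit N v"
    by (auto simp: perm_orbit_def intro!: exI[of _ id] permutes_id)
  then have "perm_orbit N v \<noteq> {}" by blast
  moreover have "w \<in> convex hull (insert 0 (perm_orbit N v))"
    using assms by (simp add: star_dominates_def)
  ultimately obtain s t \<nu> where "t \<ge> 0" "\<nu> \<in> convex hull (perm_orbit N v)" "w = s *\<^sub>R 0 + t *\<^sub>R \<nu>"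
    by (subst (asm) convex_hull_insert) auto
  then show ?thesis using that[of t \<nu>] by simp
qed

section \<open>Partitions as vectors\<close>

lemma nth_default_append_zeros:
  "length lam \<le> n \<Longrightarrow> map (nth_default 0 lam) [0..<n] = lam @ replicate (n - length lam) 0"
  by (rule nth_equalityI) (auto simp: nth_append nth_default_def)

lemma sum_nth_default:
  assumes "length lam \<le> n"
  shows "(\<Sum>i<n. real (nth_default 0 lam i)) = real (sum_list lam)"
proof -
  have "(\<Sum>i<n. nth_default 0 lam i) = sum_list (map (nth_default 0 lam) [0..<n])"
    by (simp add: sum_list_distinct_conv_sum_set atLeast0LessThan)
  then show ?thesis
    using assms by (simp add: nth_default_append_zeros sum_list_replicate flip: of_nat_sum)
qed

lemma length_le_sum_list:
  "\<forall>k\<in>set lam. 0 < k \<Longrightarrow> length lam \<le> sum_list lam" for lam :: "nat list"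
  by (induction lam) auto

text \<open>
  The parts are the nonzero entries of the vector, so the two partitions have the same multiset of
  parts, and they are both sorted.
\<close>

lemma partition_eq_if_rearranged:
  assumes lam: "is_partition lam" "length lam \<le> n" and mu: "is_partition mu" "length mu \<le> n"
    and \<rho>: "\<rho> permutes {..<n}" "\<forall>i<n. nth_default 0 mu i = nth_default 0 lam (\<rho> i)"
  shows "lam = mu"
proof -
  have parts: "mset ka = filter_mset (\<lambda>k. 0 < k) (image_mset (nth_default 0 ka) (mset_set {..<n}))"
    if "is_partition ka" "length ka \<le> n" for ka
  proof -
    have "image_mset (nth_default 0 ka) (mset_set {..<n}) = mset (map (nth_default 0 ka) [0..<n])"
      by (simp add: atLeast0LessThan)
    also have "\<dots> = mset (ka @ replicate (n - length ka) 0)"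
      using that by (simp only: nth_default_append_zeros)
    also have "filter_mset (\<lambda>k. 0 < k) \<dots> = mset ka"
      using that by (simp add: is_partition_def del: mset_append flip: mset_filter)
    finally show ?thesis by simp
  qed
  have "image_mset (nth_default 0 mu) (mset_set {..<n})
      = image_mset (nth_default 0 lam) (image_mset \<rho> (mset_set {..<n}))"
    unfolding multiset.map_comp using \<rho> by (intro image_mset_cong) auto
  then have "mset mu = mset lam"
    using parts lam mu by (simp add: permutes_image_mset[OF \<rho>(1)])
  moreover have "sorted (rev lam)" "sorted (rev mu)"
    using lam mu by (simp_all add: is_partition_def sorted_wrt_rev)
  ultimately have "rev lam = rev mu"
    by (metis mset_rev properties_for_sort)
  then show ?thesis by simp
qed

section \<open>The inequality between monomial means\<close>

theorem theorem5p10: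
  fixes lam mu :: "nat list" and N n :: nat and c \<delta> L M :: real
  assumes "is_partition lam" and "lam \<noteq> []"
    and "is_partition mu" and "mu \<noteq> []"
    and "length lam \<le> N" and "length mu \<le> N"
    and "star_dominates N (partition_vec lam) (partition_vec mu)"
    and "c > 0"
    and "L = real (sum_list lam)" and "M = real (sum_list mu)"
    and "L > M \<Longrightarrow> \<delta> = - c * ((L - M) / L) * (c * (M / L)) powr (M / (L - M))"
    and "L = M \<Longrightarrow> \<delta> = 0"
    and "n \<ge> sum_list lam"
  shows
    "(L > M \<longrightarrow>
        (\<forall>x :: nat \<Rightarrow> real. (\<forall>i<n. x i > 0) \<longrightarrow>
          partition_mean n lam x - c * partition_mean n mu x \<ge> \<delta> \<and>
          (partition_mean n lam x - c * partition_mean n mu x = \<delta> \<longleftrightarrow>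
            (\<forall>i<n. x i = (c * (M / L)) powr (1 / (L - M)))))) \<and>
     (L = M \<and> c \<le> 1 \<longrightarrow>
        (\<forall>x :: nat \<Rightarrow> real. (\<forall>i<n. x i > 0) \<longrightarrow>
          partition_mean n lam x - c * partition_mean n mu x \<ge> \<delta> \<and>
          (c \<noteq> 1 \<longrightarrow> partition_mean n lam x - c * partition_mean n mu x > \<delta>) \<and>
          (c = 1 \<and> lam = mu \<longrightarrow>
            partition_mean n lam x - c * partition_mean n mu x = \<delta>) \<and>
          (c = 1 \<and> lam \<noteq> mu \<longrightarrow>
            (partition_mean n lam x - c * partition_mean n mu x = \<delta> \<longleftrightarrow>
              (\<forall>i<n. \<forall>j<n. x i = x j)))))"
proof -
  define l where "l i = real (nth_default 0 lam i)" for i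
  define m where "m i = real (nth_default 0 mu i)" for i
  have lookup: "Poly_Mapping.lookup (partition_vec lam) = l" "Poly_Mapping.lookup (partition_vec mu) = m"
    by (auto simp: partition_vec_def l_def m_def nth_default_def fun_eq_iff)
  have lens: "length lam \<le> sum_list lam" "length mu \<le> sum_list mu"
    using assms by (auto simp: is_partition_def intro!: length_le_sum_list)
  have pos: "L > 0" "M > 0"
    using lens assms(2,4,9,10) by (cases lam; cases mu; force)+
  then have n0: "n > 0" using assms(9,13) by auto
  have lam_n: "length lam \<le> n" using lens assms(13) by simp
  have means: "partition_mean n lam x = exp_mean n l (\<lambda>i. ln (x i))"
    "partition_mean n mu x = exp_mean n m (\<lambda>i. ln (x i))" if "\<forall>i<n. x i > 0" for x
    using that by (simp_all add: partition_mean_eq_exp_mean l_def[abs_def] m_def[abs_def])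
  obtain \<theta> \<nu> where "\<theta> \<ge> 0" and mu_eq: "partition_vec mu = \<theta> *\<^sub>R \<nu>"
    and hull: "\<nu> \<in> convex hull (perm_orbit N (partition_vec lam))"
    using assms(7) by (rule star_dominates_scaled)
  define w where "w = Poly_Mapping.lookup \<nu>"
  have m_eq: "m = (\<lambda>i. \<theta> * w i)"
    using mu_eq by (simp add: w_def fun_eq_iff lookup_scaleR flip: lookup)
  have "(\<Sum>i<N. w i) = L"
    using convex_hull_perm_orbit_sum[OF hull] sum_nth_default[OF assms(5)] assms(9)
    by (simp add: lookup w_def l_def)
  moreover have "(\<Sum>i<N. m i) = M"
    using sum_nth_default[OF assms(6)] assms(10) by (simp add: m_def)
  ultimately have "M = \<theta> * L" by (simp add: m_eq flip: sum_distrib_left)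
  then have \<theta>_eq: "\<theta> = M / L" using pos by simp
  then have \<theta>_pos: "\<theta> > 0" using pos by simp
  show ?thesis
  proof (cases "L \<ge> M")
    case True
    then have mu_n: "length mu \<le> n" using lens assms(9,10,13) by simp
    have m0: "m i = 0" if "i \<ge> n" for i using that mu_n by (simp add: m_def nth_default_def)
    have sums: "(\<Sum>i<n. l i) = L" "(\<Sum>i<n. m i) = M"
      using sum_nth_default lam_n mu_n assms(9,10) by (simp_all add: l_def m_def)
    \<comment> \<open>For a non-constant \<open>y\<close>; on the diagonal both means are powers of a single number, by \<open>diag\<close>.\<close>
    have dom: "\<nu> \<in> perm_orbit n (partition_vec lam) \<or> exp_mean n w y < exp_mean n l y"
      if "\<not> (\<forall>i<n. \<forall>j<n. y i = y j)" for y
      unfolding w_def lookup(1)[symmetric]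
      using m0 \<theta>_pos lam_n that
      by (intro exp_mean_less_on_hull[OF hull]) (auto simp: lookup l_def nth_default_def m_eq w_def)
    have diag: "exp_mean n l y = exp (a * L) \<and> exp_mean n m y = exp (a * M)" if "\<forall>i<n. y i = a" for y a
      using exp_mean_const[OF that] sums by simp
    show ?thesis
    proof (cases "L = M")
      case eq: True
      then have wm: "w = m" using \<theta>_eq pos by (simp add: m_eq)
      have pm: "partition_vec mu = \<nu>" using \<theta>_eq pos eq mu_eq by simp
      have "partition_mean n lam x - c * partition_mean n mu x \<ge> \<delta> \<and>
          (c \<noteq> 1 \<longrightarrow> partition_mean n lam x - c * partition_mean n mu x > \<delta>) \<and>
          (c = 1 \<and> lam = mu \<longrightarrow> partition_mean n lam x - c * partition_mean n mu x = \<delta>) \<and>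
          (c = 1 \<and> lam \<noteq> mu \<longrightarrow>
            (partition_mean n lam x - c * partition_mean n mu x = \<delta> \<longleftrightarrow> (\<forall>i<n. \<forall>j<n. x i = x j)))"
        if x: "\<forall>i<n. x i > 0" and c1: "c \<le> 1" for x
      proof -
        define y where "y i = ln (x i)" for i
        define A where "A = partition_mean n lam x"
        define B where "B = partition_mean n mu x"
        have A: "A = exp_mean n l y" and B: "B = exp_mean n m y"
          using means[OF x] by (simp_all add: A_def B_def y_def[abs_def])
        have y_const: "(\<forall>i<n. \<forall>j<n. y i = y j) \<longleftrightarrow> (\<forall>i<n. \<forall>j<n. x i = x j)"
          using x by (auto simp: y_def)
        \<comment> \<open>Positivity makes the inequality strict for \<open>c < 1\<close>, where \<open>c * B < B \<le> A\<close>.\<close>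
        have Bpos: "B > 0"
        proof -
          have "perm_avg n (\<lambda>\<sigma>. 0) < B"
            unfolding B exp_mean_def
            by (rule perm_avg_strict_mono[of n _ _ id]) auto
          then show ?thesis by (simp add: perm_avg_const)
        qed
        have const_eq: "A = B" if const: "\<forall>i<n. \<forall>j<n. x i = x j"
        proof -
          obtain a where "\<forall>i<n. y i = a" using const n0 unfolding y_const[symmetric] by blast
          then show ?thesis using diag[of y a] eq by (simp add: A B)
        qed
        have less: "B < A" if ne: "\<not> (\<forall>i<n. \<forall>j<n. x i = x j)" and "lam \<noteq> mu"
        proof -
          have "\<nu> \<notin> perm_orbit n (partition_vec lam)"
          proof
            assume "\<nu> \<in> perm_orbit n (partition_vec lam)"
            then obtain \<rho> where "\<rho> permutes {..<n}" "\<forall>i. m i = l (\<rho> i)"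
              unfolding pm[symmetric] perm_orbit_def lookup by (auto simp: lookup)
            then have "lam = mu"
              using assms(1,3) lam_n mu_n
              by (intro partition_eq_if_rearranged[of lam n mu \<rho>]) (auto simp: m_def l_def)
            then show False using \<open>lam \<noteq> mu\<close> by simp
          qed
          then show ?thesis using dom[of y] ne by (simp add: y_const A B wm)
        qed
        have same: "lam = mu \<Longrightarrow> A = B" by (simp add: A_def B_def)
        have le: "B \<le> A"
          using less const_eq same by (cases "lam = mu"; cases "\<forall>i<n. \<forall>j<n. x i = x j") fastforce+
        have "c \<noteq> 1 \<Longrightarrow> c * B < 1 * B"
          using c1 Bpos by (intro mult_strict_right_mono) auto
        then show ?thesis
          unfolding A_def[symmetric] B_def[symmetric] assms(12)[OF eq]
          using le less const_eq same by (cases "c = 1") auto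
      qed
      then show ?thesis using eq by auto
    next
      case False
      then have LM: "L > M" using True by simp
      have \<theta>_less: "\<theta> < 1" using LM pos by (simp add: \<theta>_eq)
      define b where "b = ln (c * \<theta>) / (1 - \<theta>)"
      define K where "K = c * (1 - \<theta>) * exp (\<theta> * b)"
      have exps: "\<theta> / (1 - \<theta>) = M / (L - M)" "1 - \<theta> = (L - M) / L" "1 / ((1 - \<theta>) * L) = 1 / (L - M)"
        using pos LM by (simp_all add: \<theta>_eq field_simps)
      have \<delta>: "\<delta> = - K"
      proof -
        have "(c * (M / L)) powr (M / (L - M)) = exp (\<theta> * b)"
          unfolding \<theta>_eq[symmetric] exps(1)[symmetric]
          using assms(8) \<theta>_pos by (simp add: powr_def b_def)
        then show ?thesis
          using assms(11)[OF LM] by (simp add: K_def exps(2))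
      qed
      have optimum: "(c * (M / L)) powr (1 / (L - M)) = exp (b / L)"
        using assms(8) \<theta>_pos by (simp add: powr_def b_def \<theta>_eq[symmetric] exps(3)[symmetric])
      \<comment> \<open>\<open>n \<ge> L > M\<close> leaves room for a zero entry of \<open>\<mu>\<close>; otherwise \<open>\<nu>\<close> could be constant and
        equality could occur off the diagonal.\<close>
      have "length mu < n" using lens LM assms(9,10,13) by simp
      then have "m (n - 1) = 0" by (simp add: m_def nth_default_def)
      moreover have "m 0 \<noteq> 0"
        using assms(3,4) by (cases mu) (auto simp: m_def is_partition_def)
      ultimately have w_ne: "w 0 \<noteq> w (n - 1)" using \<theta>_pos by (auto simp: m_eq)
      have "partition_mean n lam x - c * partition_mean n mu x \<ge> \<delta> \<and>
          (partition_mean n lam x - c * partition_mean n mu x = \<delta> \<longleftrightarrow>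
            (\<forall>i<n. x i = (c * (M / L)) powr (1 / (L - M))))"
        if x: "\<forall>i<n. x i > 0" for x
      proof -
        define y where "y i = ln (x i)" for i
        have xy: "x i = exp (b / L) \<longleftrightarrow> y i = b / L" if "i < n" for i
        proof -
          have "x i = exp (y i)" using x that by (simp add: y_def)
          then show ?thesis by simp
        qed
        have "exp_mean n l y - c * exp_mean n m y \<ge> - K \<and>
          (exp_mean n l y - c * exp_mean n m y = - K \<longleftrightarrow> (\<forall>i<n. y i = b / L))"
        proof (cases "\<forall>i<n. \<forall>j<n. y i = y j")
          case True
          then obtain a where const: "\<forall>i<n. y i = a" using n0 by blast
          have "a * M = \<theta> * (a * L)" using pos by (simp add: \<theta>_eq)
          then have "exp_mean n l y = exp (a * L)" "exp_mean n m y = exp (\<theta> * (a * L))"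
            using diag[OF const] by simp_all
          moreover have "a * L = b \<longleftrightarrow> (\<forall>i<n. y i = b / L)"
            using const n0 pos by (auto simp: field_simps)
          ultimately show ?thesis
            using scaled_exp_bound[OF assms(8) \<theta>_pos \<theta>_less b_def, of "a * L"]
            by (auto simp: K_def)
        next
          case nonconst: False
          have "exp_mean n w y \<le> exp_mean n l y"
            using dom[OF nonconst] exp_mean_perm_orbit[of \<nu> n "partition_vec lam" y]
            by (auto simp: w_def lookup)
          moreover have "c * exp_mean n m y < exp_mean n w y + K"
            unfolding K_def m_eq
            using w_ne n0 nonconst
            by (intro exp_mean_scaled_bound[of _ _ _ 0 n "n - 1"] assms(8) \<theta>_pos \<theta>_less b_def) auto
          moreover have "\<not> (\<forall>i<n. y i = b / L)" using nonconst by metis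
          ultimately show ?thesis by simp
        qed
        then show ?thesis
          unfolding \<delta> optimum means[OF x] y_def[abs_def, symmetric]
          using xy by simp
      qed
      then show ?thesis using LM by auto
    qed
  qed auto
qed

end
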